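(* Let $m,n,d\ge 1$ be integers, $q\in(0,2)$, $\lambda>0$, and let $F:\mathbb{R}^{m\times n}\to\mathbb{R}$ be continuously differentiable. For $(U,V)\in\mathbb{R}^{m\times d}\times\mathbb{R}^{n\times d}$ let $$\Phi_\lambda(U,V)=F(UV^T)+\frac{\lambda}{q}\left(\|U\|_{2,q}^q+\|V\|_{2,q}^q\right).$$ Let $(U,V)$ be a critical point of $\Phi_\lambda$. Then there exists a matrix $E\in\mathbb{R}^{d\times d}$ such that, writing $(\bar U,\bar V)=(UE,VE)$: 1. $UV^T=\bar U\bar V^T$, and both $\bar U$ and $\bar V$ are column-wise orthogonal (distinct columns are orthogonal to each other); 2. either $(\bar U,\bar V)$ is also a critical point of $\Phi_\lambda$, or $(U,V)$ is not a global minimizer of $\Phi_\lambda$; 3. $(\bar U,\bar V)$ is a critical point of $\Phi_\lambda$ if and only if $D_U=D_{\bar U}$.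
   Context: $A_{:,i}$ denotes the $i$-th column of $A$, and $\|A\|_{2,q}^q=\sum_{i}\|A_{:,i}\|_2^q$. For $A\in\mathbb{R}^{k\times d}$, $D_A$ is the $d\times d$ diagonal matrix with $(D_A)_{ii}=\|A_{:,i}\|_2^{q-2}$ if $A_{:,i}\ne 0$ and $(D_A)_{ii}=0$ if $A_{:,i}=0$. The Fréchet subdifferential $\hat\partial\Phi(x)$ is the set of $g$ with $\liminf_{y\to x,\,y\ne x}\frac{\Phi(y)-\Phi(x)-\langle g,y-x\rangle}{\|y-x\|}\ge 0$; the limiting Fréchet subdifferential is $\partial\Phi(x)=\{g:\exists\,x_m\to x,\ g_m\in\hat\partial\Phi(x_m),\ g_m\to g\}$. A point $x$ is a critical point of $\Phi$ if $0\in\partial\Phi(x)$. *)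

theory Defs
  imports "HOL-Analysis.Analysis"
begin

(* The type real ^ 'd ^ 'k is the space of k x d matrices (A $ i $ j is row i, column j); its
   inner product and norm are the Frobenius ones, and those of a product of matrix spaces are the
   corresponding Euclidean ones. *)

definition frechet_subdifferential :: "('a::real_inner \<Rightarrow> real) \<Rightarrow> 'a \<Rightarrow> 'a set" where
  "frechet_subdifferential \<Phi> x =
     {g. Liminf (at x) (\<lambda>y. ereal ((\<Phi> y - \<Phi> x - g \<bullet> (y - x)) / norm (y - x))) \<ge> 0}"

definition limiting_subdifferential :: "('a::real_inner \<Rightarrow> real) \<Rightarrow> 'a \<Rightarrow> 'a set" where
  "limiting_subdifferential \<Phi> x =
     {g. \<exists>(xs :: nat \<Rightarrow> 'a) gs. xs \<longlonglongrightarrow> x \<and> (\<forall>m. gs m \<in> frechet_subdifferential \<Phi> (xs m)) \<and>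
           gs \<longlonglongrightarrow> g}"

definition critical_point :: "('a::real_inner \<Rightarrow> real) \<Rightarrow> 'a \<Rightarrow> bool" where
  "critical_point \<Phi> x \<longleftrightarrow> 0 \<in> limiting_subdifferential \<Phi> x"

definition global_minimizer :: "('a \<Rightarrow> real) \<Rightarrow> 'a \<Rightarrow> bool" where
  "global_minimizer \<Phi> x \<longleftrightarrow> (\<forall>y. \<Phi> x \<le> \<Phi> y)"

definition continuously_differentiable :: "('a::real_normed_vector \<Rightarrow> 'b::real_normed_vector) \<Rightarrow> bool" where
  "continuously_differentiable F \<longleftrightarrow>
     (\<exists>F' :: 'a \<Rightarrow> 'a \<Rightarrow>\<^sub>L 'b. (\<forall>x. (F has_derivative blinfun_apply (F' x)) (at x)) \<and>
        continuous_on UNIV F')"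

(* The q-th power of the (2,q) norm; since 0 powr q = 0, zero columns contribute 0. *)
definition norm2q_pow :: "real \<Rightarrow> real ^ 'd ^ 'k \<Rightarrow> real" where
  "norm2q_pow q A = (\<Sum>i\<in>UNIV. norm (column i A) powr q)"

definition D_mat :: "real \<Rightarrow> real ^ 'd ^ 'k \<Rightarrow> real ^ 'd ^ 'd" where
  "D_mat q A = (\<chi> i j. if i = j \<and> column i A \<noteq> 0 then norm (column i A) powr (q - 2) else 0)"

definition columnwise_orthogonal :: "real ^ 'd ^ 'k \<Rightarrow> bool" where
  "columnwise_orthogonal A \<longleftrightarrow> (\<forall>i j. i \<noteq> j \<longrightarrow> orthogonal (column i A) (column j A))"

definition Phi :: "real \<Rightarrow> real \<Rightarrow> (real ^ 'n ^ 'm \<Rightarrow> real) \<Rightarrow>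
    (real ^ 'd ^ 'm) \<times> (real ^ 'd ^ 'n) \<Rightarrow> real" where
  "Phi q lam F = (\<lambda>(U, V). F (U ** transpose V) + lam / q * (norm2q_pow q U + norm2q_pow q V))"

end

theory Submission
  imports Defs
begin

text \<open>Write \<open>G\<close> for the gradient of \<^term>\<open>F\<close> at \<open>U V\<^sup>T\<close>. A point \<open>(U, V)\<close> is critical iff
  \<open>G V + \<lambda> U D\<^sub>U = 0\<close> and \<open>G\<^sup>T U + \<lambda> V D\<^sub>V = 0\<close>: on nonzero columns \<^term>\<open>Phi\<close> is smooth, and each
  column of \<open>U\<close> vanishes together with that of \<open>V\<close>, where \<open>0\<close> is a subgradient of the norm power. These equations
  force \<open>U\<^sup>T U = V\<^sup>T V\<close>, and this matrix commutes with \<open>D\<^sub>U = D\<^sub>V\<close>. Hence it is diagonalized by some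
  orthogonal \<open>E\<close> commuting with \<open>D\<^sub>U\<close>, and the equations for \<open>(U E, V E)\<close> read
  \<open>U E (D\<^bsub>UE\<^esub> - D\<^sub>U) = 0\<close> and \<open>V E (D\<^bsub>UE\<^esub> - D\<^sub>U) = 0\<close>. Concavity of \<open>t \<mapsto> t\<^bsup>q/2\<^esup>\<close> together with
  invariance of the trace of \<open>U\<^sup>T U D\<^sub>U\<close> shows that passing to \<open>(U E, V E)\<close> does not increase \<^term>\<open>Phi\<close>, so a global
  minimizer is mapped to a global minimizer.\<close>

section \<open>Simultaneous diagonalization\<close>

lemma column_matrix_mult: "column i (A ** B) = A *v column i B"
  by (simp add: column_def matrix_matrix_mult_def matrix_vector_mult_def vec_eq_iff)

text \<open>The rotation diagonalizes the symmetric matrix with rows \<open>(a, b)\<close> and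
  \<open>(b, d)\<close>. It preserves the Frobenius norm, so clearing the off-diagonal entry adds
  \<open>2 * b^2\<close> to the sum of squares on the diagonal.\<close>

lemma exists_rotation_increasing_diagonal:
  fixes a b d :: real
  assumes "b \<noteq> 0"
  obtains c s where "c\<^sup>2 + s\<^sup>2 = 1"
    "a\<^sup>2 + d\<^sup>2 < (c\<^sup>2 * a + 2 * c * s * b + s\<^sup>2 * d)\<^sup>2 + (s\<^sup>2 * a - 2 * c * s * b + c\<^sup>2 * d)\<^sup>2"
proof -
  define R where "R = sqrt ((a - d)\<^sup>2 + (2 * b)\<^sup>2)"
  have "(2 * b)\<^sup>2 > 0"
    using assms by simp
  then have pos: "(a - d)\<^sup>2 + (2 * b)\<^sup>2 > 0"
    by (smt (verit) zero_le_power2)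
  then have R: "R > 0" and R2: "R\<^sup>2 = (a - d)\<^sup>2 + (2 * b)\<^sup>2"
    unfolding R_def by simp_all
  define p r where "p = (a - d) / R" and "r = 2 * b / R"
  have "p\<^sup>2 + r\<^sup>2 = 1"
    unfolding p_def r_def power_divide add_divide_distrib[symmetric] R2[symmetric] using R by simp
  then obtain t where t: "p = cos t" "r = sin t"
    using sincos_total_2pi by metis
  \<comment> \<open>Half the angle of the unit vector \<open>(p, r)\<close>: the new diagonal
    entries become the eigenvalues \<open>(a + d + R) / 2\<close> and
    \<open>(a + d - R) / 2\<close>.\<close>
  define c s where "c = cos (t/2)" and "s = sin (t/2)"
  have cs: "c\<^sup>2 + s\<^sup>2 = 1" and C: "c\<^sup>2 - s\<^sup>2 = p" and S: "2 * c * s = r"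
    using cos_double[of "t/2"] sin_double[of "t/2"] unfolding c_def s_def t by simp_all
  have c2: "c\<^sup>2 = (1 + p) / 2" and s2: "s\<^sup>2 = (1 - p) / 2"
    using cs C by simp_all
  have RR: "p * (a - d) + r * (2 * b) = R"
    using R R2 by (simp add: p_def r_def power2_eq_square divide_simps)
  have plus: "c\<^sup>2 * a + 2 * c * s * b + s\<^sup>2 * d = (a + d + R) / 2"
    and minus: "s\<^sup>2 * a - 2 * c * s * b + c\<^sup>2 * d = (a + d - R) / 2"
    unfolding c2 s2 S RR[symmetric] by (simp_all add: field_simps)
  have "((a + d + R) / 2)\<^sup>2 + ((a + d - R) / 2)\<^sup>2 = ((a + d)\<^sup>2 + R\<^sup>2) / 2"
    by (simp add: power2_eq_square field_simps)
  also have "\<dots> = a\<^sup>2 + d\<^sup>2 + 2 * b\<^sup>2"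
    unfolding R2 by (simp add: power2_eq_square field_simps)
  finally show ?thesis
    using assms by (intro that[OF cs]) (simp add: plus minus)
qed

lemma compact_orthogonal_matrices: "compact {E :: real ^ 'd ^ 'd. orthogonal_matrix E}"
proof -
  have "bounded {E :: real ^ 'd ^ 'd. orthogonal_matrix E}"
  proof (rule boundedI)
    fix E :: "real ^ 'd ^ 'd"
    assume "E \<in> {E. orthogonal_matrix E}"
    then have "norm (E $ i) = 1" for i
      by (metis mem_Collect_eq orthogonal_matrix_orthonormal_rows row_def vec_nth_inverse)
    then show "norm E \<le> (\<Sum>i\<in>(UNIV :: 'd set). 1)"
      by (metis (no_types, lifting) norm_le_l1_cart norm_vec_def L2_set_le_sum norm_ge_zero sum.cong)
  qed
  moreover have "closed {E :: real ^ 'd ^ 'd. orthogonal_matrix E}"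
    unfolding orthogonal_matrix matrix_matrix_mult_def transpose_def
    by (intro closed_Collect_eq continuous_intros)
  ultimately show ?thesis
    by (simp add: compact_eq_bounded_closed)
qed

text \<open>Jacobi's argument: among the admissible \<^term>\<open>E\<close>, take one maximizing the sum of squares of the
  diagonal of \<open>E\<^sup>T A E\<close>. A nonzero off-diagonal entry would allow a plane rotation that
  increases this sum.\<close>

lemma symmetric_diagonalization_respecting_blocks:
  fixes A :: "real ^ 'd ^ 'd" and \<delta> :: "'d \<Rightarrow> real"
  assumes sym: "transpose A = A"
    and blocks: "\<And>i j. \<delta> i \<noteq> \<delta> j \<Longrightarrow> A $ i $ j = 0"
  obtains E :: "real ^ 'd ^ 'd" where "orthogonal_matrix E"
    "\<And>i j. \<delta> i \<noteq> \<delta> j \<Longrightarrow> E $ i $ j = 0"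
    "\<And>i j. i \<noteq> j \<Longrightarrow> column i E \<bullet> (A *v column j E) = 0"
proof -
  define S where "S = {E :: real ^ 'd ^ 'd. orthogonal_matrix E} \<inter> {E. \<forall>i j. \<delta> i \<noteq> \<delta> j \<longrightarrow> E $ i $ j = 0}"
  define f where "f E = (\<Sum>i\<in>UNIV. (column i E \<bullet> (A *v column i E))\<^sup>2)" for E :: "real ^ 'd ^ 'd"
  have "closed {E :: real ^ 'd ^ 'd. \<forall>i j. \<delta> i \<noteq> \<delta> j \<longrightarrow> E $ i $ j = 0}"
    by (intro closed_Collect_all closed_Collect_imp open_Collect_const closed_Collect_eq continuous_intros)
  then have "compact S"
    unfolding S_def by (intro compact_Int_closed compact_orthogonal_matrices)
  moreover have "S \<noteq> {}"
  proof -
    have "mat 1 \<in> S"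
      using orthogonal_matrix_id by (auto simp: S_def mat_def)
    then show ?thesis
      by blast
  qed
  moreover have "continuous_on S f"
    unfolding f_def column_def matrix_vector_mult_def inner_vec_def
    by (intro continuous_intros)
  ultimately obtain E where "E \<in> S" and max: "\<And>E'. E' \<in> S \<Longrightarrow> f E' \<le> f E"
    using continuous_attains_sup by metis
  then have E: "orthogonal_matrix E" and Eb: "\<And>i j. \<delta> i \<noteq> \<delta> j \<Longrightarrow> E $ i $ j = 0"
    by (auto simp: S_def)
  have symB: "x \<bullet> (A *v y) = y \<bullet> (A *v x)" for x y
    by (metis sym dot_lmul_matrix inner_commute transpose_matrix_vector)
  have "column i E \<bullet> (A *v column j E) = 0" if "i \<noteq> j" for i j
  proof (rule ccontr)
    assume b: "column i E \<bullet> (A *v column j E) \<noteq> 0"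
    \<comment> \<open>\<open>A\<close> and \<open>E\<close> are block diagonal, hence so is
      \<open>E^T A E\<close>. A nonzero entry therefore lies inside one block, and rotating columns
      \<open>i\<close> and \<open>j\<close> keeps the zero pattern.\<close>
    have \<delta>: "\<delta> i = \<delta> j"
    proof (rule ccontr)
      assume ne: "\<delta> i \<noteq> \<delta> j"
      have "E $ k $ i * (A $ k $ l * E $ l $ j) = 0" for k l
        using ne Eb[of k i] Eb[of l j] blocks[of k l] by fastforce
      then have "column i E \<bullet> (A *v column j E) = 0"
        unfolding inner_vec_def column_def matrix_vector_mult_def
        by (simp only: sum_distrib_left vec_lambda_beta inner_real_def sum.neutral_const)
      with b show False
        by blast
    qed
    define a d where "a = column i E \<bullet> (A *v column i E)" and "d = column j E \<bullet> (A *v column j E)"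
    obtain c s where cs: "c\<^sup>2 + s\<^sup>2 = 1" and less: "a\<^sup>2 + d\<^sup>2 <
        (c\<^sup>2 * a + 2 * c * s * (column i E \<bullet> (A *v column j E)) + s\<^sup>2 * d)\<^sup>2 +
        (s\<^sup>2 * a - 2 * c * s * (column i E \<bullet> (A *v column j E)) + c\<^sup>2 * d)\<^sup>2"
      using exists_rotation_increasing_diagonal[OF b] .
    define E' :: "real ^ 'd ^ 'd" where "E' = (\<chi> k l. if l = i then c * E $ k $ i + s * E $ k $ j
      else if l = j then c * E $ k $ j - s * E $ k $ i else E $ k $ l)"
    have ci: "column i E' = c *\<^sub>R column i E + s *\<^sub>R column j E"
      and cj: "column j E' = c *\<^sub>R column j E - s *\<^sub>R column i E"
      and cl: "\<And>l. l \<noteq> i \<Longrightarrow> l \<noteq> j \<Longrightarrow> column l E' = column l E"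
      using that by (simp_all add: E'_def column_def vec_eq_iff)
    have n: "column k E \<bullet> column k E = 1" and o: "k \<noteq> l \<Longrightarrow> column k E \<bullet> column l E = 0" for k l
      using E by (auto simp: orthogonal_matrix_orthonormal_columns orthogonal_def norm_eq_1)
    have "orthogonal_matrix E'"
    proof (unfold orthogonal_matrix_orthonormal_columns orthogonal_def norm_eq_1, intro conjI allI impI)
      fix k
      show "column k E' \<bullet> column k E' = 1"
        using cs that
        by (cases "k = i"; cases "k = j")
          (auto simp: ci cj cl n o inner_add_left inner_add_right inner_diff_left inner_diff_right power2_eq_square)
    next
      fix k l :: 'd
      assume "k \<noteq> l"
      then show "column k E' \<bullet> column l E' = 0"
        using cs that
        by (cases "k = i"; cases "k = j"; cases "l = i"; cases "l = j")
          (auto simp: ci cj cl n o inner_add_left inner_add_right inner_diff_left inner_diff_right)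
    qed
    then have "E' \<in> S"
      using Eb \<delta> by (auto simp: S_def E'_def)
    have qi: "column i E' \<bullet> (A *v column i E') = c\<^sup>2 * a + 2 * c * s * (column i E \<bullet> (A *v column j E)) + s\<^sup>2 * d"
      unfolding ci a_def d_def using symB[of "column j E" "column i E"]
      by (simp add: inner_add_left inner_add_right matrix_vector_right_distrib matrix_vector_mult_scaleR
          power2_eq_square algebra_simps)
    have qj: "column j E' \<bullet> (A *v column j E') = s\<^sup>2 * a - 2 * c * s * (column i E \<bullet> (A *v column j E)) + c\<^sup>2 * d"
      unfolding cj a_def d_def using symB[of "column j E" "column i E"]
      by (simp add: inner_diff_left inner_diff_right matrix_vector_mult_diff_distrib matrix_vector_mult_scaleR
          power2_eq_square algebra_simps)
    have split: "f X = (column i X \<bullet> (A *v column i X))\<^sup>2 + (column j X \<bullet> (A *v column j X))\<^sup>2 +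
        (\<Sum>k\<in>UNIV - {i, j}. (column k X \<bullet> (A *v column k X))\<^sup>2)" for X
      unfolding f_def using that by (subst sum.subset_diff[of "{i, j}"]) auto
    have "(\<Sum>k\<in>UNIV - {i, j}. (column k E' \<bullet> (A *v column k E'))\<^sup>2) =
        (\<Sum>k\<in>UNIV - {i, j}. (column k E \<bullet> (A *v column k E))\<^sup>2)"
      by (intro sum.cong) (auto simp: cl)
    then have "f E < f E'"
      using less unfolding split qi qj by (simp add: a_def d_def)
    with max[OF \<open>E' \<in> S\<close>] show False
      by simp
  qed
  with E Eb show ?thesis
    by (rule that)
qed

section \<open>Frechet subgradients\<close>

text \<open>Trades the extended-real lower limit for an epsilon condition. Since \<open>at x\<close>
  excludes \<open>x\<close> itself, \<open>norm (y - x)\<close> is positive and the strict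
  inequality can be multiplied out.\<close>

lemma frechet_subdifferential_iff:
  "g \<in> frechet_subdifferential \<Phi> x \<longleftrightarrow>
    (\<forall>e>0. \<forall>\<^sub>F y in at x. \<Phi> y - \<Phi> x - g \<bullet> (y - x) > - e * norm (y - x))"
proof -
  have "g \<in> frechet_subdifferential \<Phi> x \<longleftrightarrow>
      (\<forall>e>0. \<forall>\<^sub>F y in at x. ereal (- e) < ereal ((\<Phi> y - \<Phi> x - g \<bullet> (y - x)) / norm (y - x)))"
    unfolding frechet_subdifferential_def mem_Collect_eq le_Liminf_iff
  proof (intro iffI allI impI)
    fix e :: real
    assume "\<forall>r<0. \<forall>\<^sub>F y in at x. r < ereal ((\<Phi> y - \<Phi> x - g \<bullet> (y - x)) / norm (y - x))" "e > 0"
    moreover from \<open>e > 0\<close> have "ereal (- e) < 0"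
      by simp
    ultimately show "\<forall>\<^sub>F y in at x. ereal (- e) < ereal ((\<Phi> y - \<Phi> x - g \<bullet> (y - x)) / norm (y - x))"
      by blast
  next
    fix r :: ereal
    assume *: "\<forall>e>0. \<forall>\<^sub>F y in at x. ereal (- e) < ereal ((\<Phi> y - \<Phi> x - g \<bullet> (y - x)) / norm (y - x))"
      and "r < 0"
    \<comment> \<open>\<open>r\<close> may be minus infinity, so a real bound between
      \<open>r\<close> and \<open>0\<close> is inserted.\<close>
    then obtain t where t: "r < ereal t" "ereal t < 0"
      using ereal_dense2 by blast
    then have "\<forall>\<^sub>F y in at x. ereal (- (- t)) < ereal ((\<Phi> y - \<Phi> x - g \<bullet> (y - x)) / norm (y - x))"
      by (intro *[rule_format]) simp
    then show "\<forall>\<^sub>F y in at x. r < ereal ((\<Phi> y - \<Phi> x - g \<bullet> (y - x)) / norm (y - x))"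
      by eventually_elim (use t in \<open>auto intro: less_trans\<close>)
  qed
  also have "\<dots> \<longleftrightarrow> (\<forall>e>0. \<forall>\<^sub>F y in at x. \<Phi> y - \<Phi> x - g \<bullet> (y - x) > - e * norm (y - x))"
    by (intro all_cong imp_cong refl eventually_cong[OF eventually_at_filter[THEN iffD2]])
      (auto simp: field_simps)
  finally show ?thesis .
qed

text \<open>The quotient for \<Phi> dominates the one for the touching minorant \<Psi>, which tends
  to \<open>0\<close>. Global minimizers use a constant \<Psi>; zero columns are handled by dropping
  their norm terms.\<close>

lemma frechet_subdifferential_lower_bound:
  assumes deriv: "(\<Psi> has_derivative (\<lambda>h. g \<bullet> h)) (at x)"
    and le: "\<And>y. \<Psi> y \<le> \<Phi> y" and eq: "\<Psi> x = \<Phi> x"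
  shows "g \<in> frechet_subdifferential \<Phi> x"
  unfolding frechet_subdifferential_iff
proof (intro allI impI)
  fix e :: real
  assume "e > 0"
  then obtain d where d: "d > 0" "\<And>y. norm (y - x) < d \<Longrightarrow>
      norm (\<Psi> y - \<Psi> x - g \<bullet> (y - x)) \<le> e / 2 * norm (y - x)"
    using deriv unfolding has_derivative_at_alt by (meson half_gt_zero)
  show "\<forall>\<^sub>F y in at x. \<Phi> y - \<Phi> x - g \<bullet> (y - x) > - e * norm (y - x)"
    unfolding eventually_at
  proof (intro exI[of _ d] conjI ballI impI)
    fix y assume y: "y \<noteq> x \<and> dist y x < d"
    then have "norm (\<Psi> y - \<Psi> x - g \<bullet> (y - x)) \<le> e / 2 * norm (y - x)"
      by (intro d) (simp add: dist_norm)
    moreover have "e * norm (y - x) > 0"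
      using y \<open>e > 0\<close> by simp
    moreover note le[of y] eq
    ultimately show "\<Phi> y - \<Phi> x - g \<bullet> (y - x) > - e * norm (y - x)"
      unfolding real_norm_def by argo
  qed (fact d)
qed

text \<open>Dividing the subgradient inequality by \<open>t > 0\<close> gives
  \<open>g \<bullet> d \<le> c\<close> in the limit, dividing by \<open>t < 0\<close> gives the
  reverse. Only differentiability along one line enters, so \<Phi> may be nonsmooth at
  \<open>x\<close>.\<close>

lemma frechet_subdifferential_directional:
  assumes g: "g \<in> frechet_subdifferential \<Phi> x"
    and deriv: "((\<lambda>t. \<Phi> (x + t *\<^sub>R d)) has_real_derivative c) (at 0)"
  shows "g \<bullet> d = c"
proof (cases "d = 0")
  case True
  with deriv have "((\<lambda>t. \<Phi> x) has_real_derivative c) (at 0)"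
    by simp
  with DERIV_const have "c = 0"
    by (rule DERIV_unique[rotated])
  with True show ?thesis by simp
next
  case False
  define Q where "Q t = (\<Phi> (x + t *\<^sub>R d) - \<Phi> x) / t" for t
  have Q: "(Q \<longlongrightarrow> c) (at 0)"
    using deriv unfolding Q_def DERIV_def by simp
  have lim: "filterlim (\<lambda>t. x + t *\<^sub>R d) (at x) (at 0)"
    unfolding filterlim_at
    using False by (auto intro!: tendsto_eq_intros simp: eventually_at_filter)
  have ev: "\<forall>\<^sub>F t in at 0. \<Phi> (x + t *\<^sub>R d) - \<Phi> x - t * (g \<bullet> d) > - e * (\<bar>t\<bar> * norm d)" if "e > 0" for e
  proof -
    have "\<forall>\<^sub>F y in at x. \<Phi> y - \<Phi> x - g \<bullet> (y - x) > - e * norm (y - x)"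
      using g that unfolding frechet_subdifferential_iff by blast
    from eventually_compose_filterlim[OF this lim] show ?thesis
      by simp
  qed
  have "\<bar>c - g \<bullet> d\<bar> \<le> 0 + e" if "e > 0" for e
  proof -
    define \<epsilon> where "\<epsilon> = e / norm d"
    have \<epsilon>: "\<epsilon> > 0" "\<epsilon> * norm d = e"
      using that False by (simp_all add: \<epsilon>_def)
    have "g \<bullet> d - e \<le> c"
    proof (rule tendsto_lowerbound)
      show "(Q \<longlongrightarrow> c) (at_right 0)"
        using Q by (simp add: filterlim_at_split)
      have "\<forall>\<^sub>F t in at_right 0. \<Phi> (x + t *\<^sub>R d) - \<Phi> x - t * (g \<bullet> d) > - \<epsilon> * (\<bar>t\<bar> * norm d)"
        using ev[OF \<epsilon>(1)] by (simp add: eventually_at_split)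
      then show "\<forall>\<^sub>F t in at_right 0. g \<bullet> d - e \<le> Q t"
        using eventually_at_right_less[of 0]
        by eventually_elim (auto simp: Q_def field_simps simp flip: \<epsilon>(2))
    qed simp
    moreover have "c \<le> g \<bullet> d + e"
    proof (rule tendsto_upperbound)
      show "(Q \<longlongrightarrow> c) (at_left 0)"
        using Q by (simp add: filterlim_at_split)
      have "\<forall>\<^sub>F t in at_left 0. \<Phi> (x + t *\<^sub>R d) - \<Phi> x - t * (g \<bullet> d) > - \<epsilon> * (\<bar>t\<bar> * norm d)"
        using ev[OF \<epsilon>(1)] by (simp add: eventually_at_split)
      moreover have "\<forall>\<^sub>F t in at_left (0::real). t < 0"
        by (simp add: eventually_at_filter)
      ultimately show "\<forall>\<^sub>F t in at_left 0. Q t \<le> g \<bullet> d + e"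
        by eventually_elim (auto simp: Q_def field_simps simp flip: \<epsilon>(2))
    qed simp
    ultimately show ?thesis
      by linarith
  qed
  then have "\<bar>c - g \<bullet> d\<bar> \<le> 0"
    by (rule field_le_epsilon)
  then show ?thesis by simp
qed

lemma critical_pointI_frechet: "0 \<in> frechet_subdifferential \<Phi> x \<Longrightarrow> critical_point \<Phi> x"
  unfolding critical_point_def limiting_subdifferential_def
  by (intro CollectI exI[of _ "\<lambda>_. x"] exI[of _ "\<lambda>_. 0"]) simp

lemma global_minimizer_critical_point:
  assumes "global_minimizer \<Phi> x"
  shows "critical_point \<Phi> x"
proof (rule critical_pointI_frechet, rule frechet_subdifferential_lower_bound)
  show "((\<lambda>_. \<Phi> x) has_derivative (\<lambda>h. 0 \<bullet> h)) (at x)"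
    by simp
  show "\<Phi> x \<le> \<Phi> y" for y
    using assms by (simp add: global_minimizer_def)
qed simp

text \<open>Chain rule through the norm. Absorbing the division by \<open>norm u\<close> turns the
  exponent \<open>q - 1\<close> into \<open>q - 2\<close>, the one of \<open>D_mat\<close>.\<close>

lemma has_derivative_norm_powr:
  fixes u :: "'a::real_inner"
  assumes "u \<noteq> 0"
  shows "((\<lambda>u. norm u powr q) has_derivative (\<lambda>h. q * (norm u powr (q - 2) * (u \<bullet> h)))) (at u)"
proof -
  have "((\<lambda>u. norm u powr q) has_derivative (\<lambda>h. (u \<bullet> h / norm u) * (q * norm u powr (q - 1)))) (at u)"
    using has_derivative_compose[OF has_derivative_norm[OF assms]
        has_real_derivative_powr[of "norm u" q, THEN has_field_derivative_imp_has_derivative]] assms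
    by (simp add: sgn_div_norm inner_commute divide_inverse mult_ac)
  moreover have "norm u powr (q - 1) = norm u powr (q - 2) * norm u"
    using assms powr_mult_base[of "norm u" "q - 2"] by (simp add: mult.commute)
  ultimately show ?thesis
    using assms by (simp add: field_simps)
qed

section \<open>Critical points of the objective\<close>

lemma inner_matrix_mult_transpose:
  fixes G :: "real ^ 'n ^ 'm" and U :: "real ^ 'd ^ 'm" and V :: "real ^ 'd ^ 'n"
  shows "G \<bullet> (U ** transpose V) = (\<Sum>i\<in>UNIV. column i U \<bullet> (G *v column i V))"
proof -
  have "G \<bullet> (U ** transpose V) = (\<Sum>a\<in>UNIV. \<Sum>b\<in>UNIV. \<Sum>i\<in>UNIV. U $ a $ i * (G $ a $ b * V $ b $ i))"
    by (simp add: inner_vec_def matrix_matrix_mult_def transpose_def sum_distrib_left mult_ac)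
  also have "\<dots> = (\<Sum>a\<in>UNIV. \<Sum>i\<in>UNIV. \<Sum>b\<in>UNIV. U $ a $ i * (G $ a $ b * V $ b $ i))"
    by (intro sum.cong refl sum.swap)
  also have "\<dots> = (\<Sum>i\<in>UNIV. \<Sum>a\<in>UNIV. \<Sum>b\<in>UNIV. U $ a $ i * (G $ a $ b * V $ b $ i))"
    by (rule sum.swap)
  also have "\<dots> = (\<Sum>i\<in>UNIV. column i U \<bullet> (G *v column i V))"
    by (simp add: inner_vec_def column_def matrix_vector_mult_def sum_distrib_left)
  finally show ?thesis .
qed

lemma inner_transpose_matrix_vector:
  fixes M :: "real ^ 'n ^ 'm"
  shows "x \<bullet> (M *v y) = y \<bullet> (transpose M *v x)"
  by (simp add: dot_lmul_matrix[symmetric] inner_commute)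

lemma bounded_bilinear_matrix_mult_transpose:
  "bounded_bilinear (\<lambda>(U :: real ^ 'd ^ 'm) (V :: real ^ 'd ^ 'n). U ** transpose V)"
  unfolding bilinear_conv_bounded_bilinear[symmetric] bilinear_def
  by (intro conjI allI linearI)
    (simp_all add: vec_eq_iff matrix_matrix_mult_def transpose_def sum.distrib sum_distrib_left algebra_simps)

lemma bounded_linear_column: "bounded_linear (column i :: real ^ 'd ^ 'k \<Rightarrow> real ^ 'k)"
  by (intro linear_conv_bounded_linear[THEN iffD1] linearI) (simp_all add: column_def vec_eq_iff)

text \<open>Riesz representation in coordinates: \<open>G X\<close> is assembled from the values of
  the derivative on \<open>Basis\<close>, so it inherits continuity.\<close>

lemma continuously_differentiable_gradient:
  fixes F :: "'a::euclidean_space \<Rightarrow> real"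
  assumes "continuously_differentiable F"
  obtains G where "continuous_on UNIV G" "\<And>X. (F has_derivative (\<lambda>h. G X \<bullet> h)) (at X)"
proof -
  obtain F' :: "'a \<Rightarrow> 'a \<Rightarrow>\<^sub>L real" where F': "\<And>X. (F has_derivative F' X) (at X)" "continuous_on UNIV F'"
    using assms unfolding continuously_differentiable_def by blast
  define G where "G X = (\<Sum>b\<in>Basis. F' X b *\<^sub>R b)" for X
  have "G X \<bullet> h = F' X h" for X h
  proof -
    have "F' X h = F' X (\<Sum>b\<in>Basis. (h \<bullet> b) *\<^sub>R b)"
      by (simp add: euclidean_representation)
    also have "\<dots> = (\<Sum>b\<in>Basis. (h \<bullet> b) * F' X b)"
      by (simp add: blinfun.sum_right blinfun.scaleR_right)
    also have "\<dots> = G X \<bullet> h"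
      by (simp add: G_def inner_sum_left inner_commute[of h] mult.commute)
    finally show ?thesis ..
  qed
  then have "(F has_derivative (\<lambda>h. G X \<bullet> h)) (at X)" for X
    using F'(1)[of X] by simp
  moreover have "continuous_on UNIV G"
    unfolding G_def using F'(2) by (intro continuous_intros)
  ultimately show ?thesis
    using that by blast
qed

text \<open>\<^term>\<open>Phi\<close> with the column norms restricted to index sets; it is differentiable wherever the
  selected columns are nonzero, and coincides with \<^term>\<open>Phi\<close> up to a constant along directions that
  change only those columns.\<close>

definition partial_Phi :: "real \<Rightarrow> real \<Rightarrow> (real ^ 'n ^ 'm \<Rightarrow> real) \<Rightarrow> 'd set \<Rightarrow> 'd set \<Rightarrow>
    (real ^ 'd ^ 'm) \<times> (real ^ 'd ^ 'n) \<Rightarrow> real" where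
  "partial_Phi q lam F S T x = F (fst x ** transpose (snd x)) +
     lam / q * ((\<Sum>i\<in>S. norm (column i (fst x)) powr q) + (\<Sum>i\<in>T. norm (column i (snd x)) powr q))"

lemma Phi_eq_partial_Phi: "Phi q lam F = partial_Phi q lam F UNIV UNIV"
  by (auto simp: fun_eq_iff Phi_def partial_Phi_def norm2q_pow_def)

lemma Phi_split:
  "Phi q lam F x = partial_Phi q lam F S T x +
     lam / q * ((\<Sum>i\<in>-S. norm (column i (fst x)) powr q) + (\<Sum>i\<in>-T. norm (column i (snd x)) powr q))"
proof -
  have split: "sum f UNIV = sum f S + sum f (- S)" for f :: "'c \<Rightarrow> real" and S
    using sum.subset_diff[of S UNIV f] by (simp add: Compl_eq_Diff_UNIV add.commute)
  show ?thesis
    using split[of "\<lambda>i. norm (column i (fst x)) powr q" S] split[of "\<lambda>i. norm (column i (snd x)) powr q" T]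
    by (simp add: Phi_eq_partial_Phi partial_Phi_def algebra_simps)
qed

text \<open>Zero columns need no case distinction here or for the entries of \<^const>\<open>D_mat\<close>, as
  \<^prop>\<open>0 powr a = (0 :: real)\<close> for every exponent, negative ones included.\<close>

definition column_gradient :: "real \<Rightarrow> real \<Rightarrow> real ^ 'n ^ 'm \<Rightarrow> real ^ 'd ^ 'm \<Rightarrow> real ^ 'd ^ 'n \<Rightarrow> 'd \<Rightarrow> real ^ 'm" where
  "column_gradient q lam M A B i = M *v column i B + (lam * norm (column i A) powr (q - 2)) *\<^sub>R column i A"

text \<open>The differential of \<open>Phi\<close> regrouped by columns. At zero columns, where
  \<open>Phi\<close> need not be differentiable, it is a formal expression in which the norm term
  contributes \<open>0\<close>.\<close>

definition Phi_deriv :: "real \<Rightarrow> real \<Rightarrow> real ^ 'n ^ 'm \<Rightarrow> (real ^ 'd ^ 'm) \<times> (real ^ 'd ^ 'n) \<Rightarrow>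
    (real ^ 'd ^ 'm) \<times> (real ^ 'd ^ 'n) \<Rightarrow> real" where
  "Phi_deriv q lam M x h =
     (\<Sum>i\<in>UNIV. column_gradient q lam M (fst x) (snd x) i \<bullet> column i (fst h)) +
     (\<Sum>i\<in>UNIV. column_gradient q lam (transpose M) (snd x) (fst x) i \<bullet> column i (snd h))"

lemma has_derivative_partial_Phi:
  fixes x :: "(real ^ 'd ^ 'm) \<times> (real ^ 'd ^ 'n)"
  assumes F: "(F has_derivative (\<lambda>h. M \<bullet> h)) (at (fst x ** transpose (snd x)))" and q: "q \<noteq> 0"
    and S: "\<And>i. i \<in> S \<Longrightarrow> column i (fst x) \<noteq> 0" and T: "\<And>i. i \<in> T \<Longrightarrow> column i (snd x) \<noteq> 0"
  shows "(partial_Phi q lam F S T has_derivative (\<lambda>h.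
      M \<bullet> (fst x ** transpose (snd h) + fst h ** transpose (snd x)) + lam / q *
      ((\<Sum>i\<in>S. q * (norm (column i (fst x)) powr (q - 2) * (column i (fst x) \<bullet> column i (fst h)))) +
       (\<Sum>i\<in>T. q * (norm (column i (snd x)) powr (q - 2) * (column i (snd x) \<bullet> column i (snd h))))))) (at x)"
proof -
  have fstd: "(fst has_derivative fst) (at x)" and sndd: "(snd has_derivative snd) (at x)"
    by (intro bounded_linear_imp_has_derivative bounded_linear_fst bounded_linear_snd)+
  have prod: "((\<lambda>x. fst x ** transpose (snd x)) has_derivative
      (\<lambda>h. fst x ** transpose (snd h) + fst h ** transpose (snd x))) (at x)"
    by (rule bounded_bilinear.FDERIV[OF bounded_bilinear_matrix_mult_transpose fstd sndd])
  have col_fst: "((\<lambda>x. norm (column i (fst x)) powr q) has_derivative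
      (\<lambda>h. q * (norm (column i (fst x)) powr (q - 2) * (column i (fst x) \<bullet> column i (fst h))))) (at x)" if "i \<in> S" for i
    by (rule has_derivative_compose[OF bounded_linear.has_derivative[OF bounded_linear_column fstd]
          has_derivative_norm_powr[OF S[OF that]]])
  have col_snd: "((\<lambda>x. norm (column i (snd x)) powr q) has_derivative
      (\<lambda>h. q * (norm (column i (snd x)) powr (q - 2) * (column i (snd x) \<bullet> column i (snd h))))) (at x)" if "i \<in> T" for i
    by (rule has_derivative_compose[OF bounded_linear.has_derivative[OF bounded_linear_column sndd]
          has_derivative_norm_powr[OF T[OF that]]])
  show ?thesis
    unfolding partial_Phi_def
    by (intro has_derivative_add has_derivative_mult_right has_derivative_sum
        has_derivative_compose[OF prod F] col_fst col_snd)
qed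

text \<open>The orthogonality conditions cover two uses: \<open>h\<close> vanishes in the omitted
  columns (necessity of the critical equations), or \<open>x\<close> does (sufficiency).\<close>

lemma partial_Phi_deriv_eq_Phi_deriv:
  fixes x h :: "(real ^ 'd ^ 'm) \<times> (real ^ 'd ^ 'n)"
  assumes q: "q \<noteq> 0"
    and S: "\<And>i. i \<notin> S \<Longrightarrow> column i (fst x) \<bullet> column i (fst h) = 0"
    and T: "\<And>i. i \<notin> T \<Longrightarrow> column i (snd x) \<bullet> column i (snd h) = 0"
  shows "M \<bullet> (fst x ** transpose (snd h) + fst h ** transpose (snd x)) + lam / q *
      ((\<Sum>i\<in>S. q * (norm (column i (fst x)) powr (q - 2) * (column i (fst x) \<bullet> column i (fst h)))) +
       (\<Sum>i\<in>T. q * (norm (column i (snd x)) powr (q - 2) * (column i (snd x) \<bullet> column i (snd h))))) =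
     Phi_deriv q lam M x h"
proof -
  have sum_S: "(\<Sum>i\<in>S. q * (norm (column i (fst x)) powr (q - 2) * (column i (fst x) \<bullet> column i (fst h)))) =
      (\<Sum>i\<in>UNIV. q * (norm (column i (fst x)) powr (q - 2) * (column i (fst x) \<bullet> column i (fst h))))"
    using S by (intro sum.mono_neutral_left) auto
  have sum_T: "(\<Sum>i\<in>T. q * (norm (column i (snd x)) powr (q - 2) * (column i (snd x) \<bullet> column i (snd h)))) =
      (\<Sum>i\<in>UNIV. q * (norm (column i (snd x)) powr (q - 2) * (column i (snd x) \<bullet> column i (snd h))))"
    using T by (intro sum.mono_neutral_left) auto
  have M: "M \<bullet> (fst x ** transpose (snd h) + fst h ** transpose (snd x)) =
      (\<Sum>i\<in>UNIV. (transpose M *v column i (fst x)) \<bullet> column i (snd h)) +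
      (\<Sum>i\<in>UNIV. (M *v column i (snd x)) \<bullet> column i (fst h))"
    unfolding inner_add_right inner_matrix_mult_transpose
    by (subst inner_transpose_matrix_vector) (simp only: inner_commute)
  show ?thesis
    unfolding sum_S sum_T M Phi_deriv_def column_gradient_def using q
    by (simp add: inner_add_left sum.distrib sum_distrib_left distrib_left mult.assoc)
qed

lemma tendsto_matrix_vector_mult [tendsto_intros]:
  fixes A :: "'a \<Rightarrow> real ^ 'n ^ 'm"
  assumes "(A \<longlongrightarrow> A0) net" "(x \<longlongrightarrow> x0) net"
  shows "((\<lambda>t. A t *v x t) \<longlongrightarrow> A0 *v x0) net"
  unfolding matrix_vector_mult_def using assms by (intro tendsto_intros)

lemma tendsto_transpose [tendsto_intros]:
  fixes A :: "'a \<Rightarrow> real ^ 'n ^ 'm"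
  assumes "(A \<longlongrightarrow> A0) net"
  shows "((\<lambda>t. transpose (A t)) \<longlongrightarrow> transpose A0) net"
  unfolding transpose_def using assms by (intro tendsto_intros)

text \<open>The limit column is kept away from \<open>0\<close>, where a power with negative
  exponent is discontinuous.\<close>

lemma tendsto_column_gradient:
  assumes "(M \<longlongrightarrow> M0) net" "(A \<longlongrightarrow> A0) net" "(B \<longlongrightarrow> B0) net" "column i A0 \<noteq> 0"
  shows "((\<lambda>t. column_gradient q lam (M t) (A t) (B t) i) \<longlongrightarrow> column_gradient q lam M0 A0 B0 i) net"
  unfolding column_gradient_def using assms
  by (intro tendsto_intros bounded_linear.tendsto[OF bounded_linear_column]) auto

text \<open>Directions supported on the nonzero columns of the limit point are supported on nonzero columns
  along the approximating sequence as well, so the Frechet subgradients there are determined by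
  derivatives, which converge.\<close>

lemma critical_point_Phi_deriv_eq_0:
  fixes x h :: "(real ^ 'd ^ 'm) \<times> (real ^ 'd ^ 'n)"
  assumes G: "continuous_on UNIV G" "\<And>X. (F has_derivative (\<lambda>h. G X \<bullet> h)) (at X)"
    and q: "q \<noteq> 0" and crit: "critical_point (Phi q lam F) x"
    and h1: "\<And>i. column i (fst x) = 0 \<Longrightarrow> column i (fst h) = 0"
    and h2: "\<And>i. column i (snd x) = 0 \<Longrightarrow> column i (snd h) = 0"
  shows "Phi_deriv q lam (G (fst x ** transpose (snd x))) x h = 0"
proof -
  obtain xs gs where xs: "xs \<longlonglongrightarrow> x" and gs: "gs \<longlonglongrightarrow> 0"
    and sub: "\<And>m. gs m \<in> frechet_subdifferential (Phi q lam F) (xs m)"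
    using crit unfolding critical_point_def limiting_subdifferential_def by blast
  define S T where "S = {i. column i (fst x) \<noteq> 0}" and "T = {i. column i (snd x) \<noteq> 0}"
  have fst_xs: "(\<lambda>m. fst (xs m)) \<longlonglongrightarrow> fst x" and snd_xs: "(\<lambda>m. snd (xs m)) \<longlonglongrightarrow> snd x"
    using xs by (auto intro: tendsto_intros)
  have "(\<lambda>m. fst (xs m) ** transpose (snd (xs m))) \<longlonglongrightarrow> fst x ** transpose (snd x)"
    by (rule bounded_bilinear.tendsto[OF bounded_bilinear_matrix_mult_transpose fst_xs snd_xs])
  then have Gs: "(\<lambda>m. G (fst (xs m) ** transpose (snd (xs m)))) \<longlonglongrightarrow> G (fst x ** transpose (snd x))"
    using G(1) by (intro isCont_tendsto_compose[of _ G]) (simp_all add: continuous_on_eq_continuous_at)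
  have "(\<lambda>m. Phi_deriv q lam (G (fst (xs m) ** transpose (snd (xs m)))) (xs m) h)
      \<longlonglongrightarrow> Phi_deriv q lam (G (fst x ** transpose (snd x))) x h"
    unfolding Phi_deriv_def
  proof (intro tendsto_add tendsto_sum)
    fix i
    show "(\<lambda>m. column_gradient q lam (G (fst (xs m) ** transpose (snd (xs m)))) (fst (xs m)) (snd (xs m)) i \<bullet> column i (fst h))
        \<longlonglongrightarrow> column_gradient q lam (G (fst x ** transpose (snd x))) (fst x) (snd x) i \<bullet> column i (fst h)"
      using h1[of i]
      by (cases "column i (fst x) = 0")
        (auto intro!: tendsto_inner tendsto_column_gradient Gs fst_xs snd_xs)
    show "(\<lambda>m. column_gradient q lam (transpose (G (fst (xs m) ** transpose (snd (xs m))))) (snd (xs m)) (fst (xs m)) i \<bullet> column i (snd h))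
        \<longlonglongrightarrow> column_gradient q lam (transpose (G (fst x ** transpose (snd x)))) (snd x) (fst x) i \<bullet> column i (snd h)"
      using h2[of i]
      by (cases "column i (snd x) = 0")
        (auto intro!: tendsto_inner tendsto_column_gradient tendsto_transpose Gs fst_xs snd_xs)
  qed
  moreover have "\<forall>\<^sub>F m in sequentially.
      Phi_deriv q lam (G (fst (xs m) ** transpose (snd (xs m)))) (xs m) h = gs m \<bullet> h"
  proof -
    have "\<forall>\<^sub>F m in sequentially. \<forall>i\<in>S. column i (fst (xs m)) \<noteq> 0"
      by (intro eventually_ball_finite ballI
          tendsto_imp_eventually_ne[OF bounded_linear.tendsto[OF bounded_linear_column fst_xs]]) (simp_all add: S_def)
    moreover have "\<forall>\<^sub>F m in sequentially. \<forall>i\<in>T. column i (snd (xs m)) \<noteq> 0"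
      by (intro eventually_ball_finite ballI
          tendsto_imp_eventually_ne[OF bounded_linear.tendsto[OF bounded_linear_column snd_xs]]) (simp_all add: T_def)
    ultimately show ?thesis
    proof eventually_elim
      case (elim m)
      define y where "y = xs m"
      \<comment> \<open>Columns outside \<open>S\<close> and \<open>T\<close> may be nonzero at
        \<open>y\<close>, but \<open>h\<close> does not move them, so their norm powers stay
        constant along the line.\<close>
      define C where "C = lam / q * ((\<Sum>i\<in>-S. norm (column i (fst y)) powr q) + (\<Sum>i\<in>-T. norm (column i (snd y)) powr q))"
      have "column i (fst (y + t *\<^sub>R h)) = column i (fst y)" if "i \<notin> S" for i t
        using h1[of i] that by (simp add: S_def column_def vec_eq_iff)
      moreover have "column i (snd (y + t *\<^sub>R h)) = column i (snd y)" if "i \<notin> T" for i t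
        using h2[of i] that by (simp add: T_def column_def vec_eq_iff)
      ultimately have Phi: "Phi q lam F (y + t *\<^sub>R h) = partial_Phi q lam F S T (y + t *\<^sub>R h) + C" for t
        unfolding Phi_split[of _ _ _ _ S T] C_def by simp
      let ?D = "\<lambda>h. G (fst y ** transpose (snd y)) \<bullet> (fst y ** transpose (snd h) + fst h ** transpose (snd y)) + lam / q *
        ((\<Sum>i\<in>S. q * (norm (column i (fst y)) powr (q - 2) * (column i (fst y) \<bullet> column i (fst h)))) +
         (\<Sum>i\<in>T. q * (norm (column i (snd y)) powr (q - 2) * (column i (snd y) \<bullet> column i (snd h)))))"
      have D: "(partial_Phi q lam F S T has_derivative ?D) (at y)"
        using elim by (intro has_derivative_partial_Phi G q) (auto simp: y_def)
      have "((\<lambda>t. y + t *\<^sub>R h) has_derivative (\<lambda>t. t *\<^sub>R h)) (at (0::real))"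
        by (auto intro!: derivative_eq_intros)
      moreover have "(partial_Phi q lam F S T has_derivative ?D) (at (y + 0 *\<^sub>R h))"
        using D by simp
      ultimately have "((\<lambda>t. partial_Phi q lam F S T (y + t *\<^sub>R h)) has_derivative (\<lambda>t. ?D (t *\<^sub>R h))) (at 0)"
        by (rule has_derivative_compose)
      moreover have "?D (t *\<^sub>R h) = ?D h * t" for t
        using linear_scale[OF has_derivative_linear[OF D], of t h] by (simp add: mult.commute)
      ultimately have "((\<lambda>t. Phi q lam F (y + t *\<^sub>R h)) has_real_derivative ?D h) (at 0)"
        unfolding Phi has_field_derivative_def
        by (intro has_derivative_add_const) simp
      then have "gs m \<bullet> h = ?D h"
        using sub by (intro frechet_subdifferential_directional) (simp_all add: y_def)
      also have "\<dots> = Phi_deriv q lam (G (fst y ** transpose (snd y))) y h"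
        by (intro partial_Phi_deriv_eq_Phi_deriv q) (use h1 h2 in \<open>auto simp: S_def T_def\<close>)
      finally show ?case
        by (simp add: y_def)
    qed
  qed
  ultimately have "(\<lambda>m. gs m \<bullet> h) \<longlonglongrightarrow> Phi_deriv q lam (G (fst x ** transpose (snd x))) x h"
    by (rule Lim_transform_eventually)
  moreover have "(\<lambda>m. gs m \<bullet> h) \<longlonglongrightarrow> 0"
    using tendsto_inner[OF gs tendsto_const, of h] by simp
  ultimately show ?thesis
    by (rule LIMSEQ_unique)
qed

text \<open>\<open>M\<close> is a separate parameter because \<open>(U, V)\<close> and
  \<open>(U ** E, V ** E)\<close> share the same product and hence the same gradient of
  \<open>F\<close>.\<close>

definition critical_equations :: "real \<Rightarrow> real \<Rightarrow> real ^ 'n ^ 'm \<Rightarrow> real ^ 'd ^ 'm \<Rightarrow> real ^ 'd ^ 'n \<Rightarrow> bool" where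
  "critical_equations q lam M U V \<longleftrightarrow>
     (\<forall>i. column_gradient q lam M U V i = 0 \<and> column_gradient q lam (transpose M) V U i = 0)"

text \<open>A nonzero column of one factor makes the norm term in its equation nonzero, which forces
  the matching column of the other factor to be nonzero. Where both vanish, both equations are
  trivial.\<close>

lemma critical_equationsI:
  assumes "lam \<noteq> 0"
    and U: "\<And>i. column i U \<noteq> 0 \<Longrightarrow> column_gradient q lam M U V i = 0"
    and V: "\<And>i. column i V \<noteq> 0 \<Longrightarrow> column_gradient q lam (transpose M) V U i = 0"
  shows "critical_equations q lam M U V"
proof -
  have "column i U = 0 \<longleftrightarrow> column i V = 0" for i
    using U[of i] V[of i] \<open>lam \<noteq> 0\<close> by (force simp: column_gradient_def simp del: transpose_matrix_vector)
  then show ?thesis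
    using U V unfolding critical_equations_def
    by (metis add_0 column_gradient_def matrix_vector_mult_0_right scaleR_zero_right)
qed

text \<open>Necessity tests the vanishing derivative on single columns. For sufficiency, omitting
  the zero columns leaves a differentiable minorant that touches \<open>Phi\<close> at
  \<open>(U, V)\<close>.\<close>

lemma critical_point_Phi_iff:
  fixes U :: "real ^ 'd ^ 'm" and V :: "real ^ 'd ^ 'n"
  assumes G: "continuous_on UNIV G" "\<And>X. (F has_derivative (\<lambda>h. G X \<bullet> h)) (at X)"
    and q: "q > 0" and lam: "lam > 0"
  shows "critical_point (Phi q lam F) (U, V) \<longleftrightarrow> critical_equations q lam (G (U ** transpose V)) U V"
proof
  assume crit: "critical_point (Phi q lam F) (U, V)"
  let ?M = "G (U ** transpose V)"
  have deriv: "Phi_deriv q lam ?M (U, V) (H, K) = 0"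
    if "\<And>i. column i U = 0 \<Longrightarrow> column i H = 0" "\<And>i. column i V = 0 \<Longrightarrow> column i K = 0" for H K
    using critical_point_Phi_deriv_eq_0[OF G _ crit, of "(H, K)"] q that by simp
  define H :: "'d \<Rightarrow> real ^ 'm \<Rightarrow> real ^ 'd ^ 'm" where "H i w = (\<chi> a b. if b = i then w $ a else 0)" for i w
  define K :: "'d \<Rightarrow> real ^ 'n \<Rightarrow> real ^ 'd ^ 'n" where "K i w = (\<chi> a b. if b = i then w $ a else 0)" for i w
  have col: "column j (H i w) = (if j = i then w else 0)" "column j (K i w') = (if j = i then w' else 0)"
     "column j (0 :: real ^ 'd ^ 'n) = 0" "column j (0 :: real ^ 'd ^ 'm) = 0" for i j w w'
    by (simp_all add: H_def K_def column_def vec_eq_iff)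
  show "critical_equations q lam ?M U V"
  proof (rule critical_equationsI)
    fix i assume i: "column i U \<noteq> 0"
    \<comment> \<open>The test direction is the column gradient itself, so the derivative equals its
      squared norm.\<close>
    have "Phi_deriv q lam ?M (U, V) (H i (column_gradient q lam ?M U V i), 0) = 0"
      by (intro deriv) (use i in \<open>auto simp: col\<close>)
    then show "column_gradient q lam ?M U V i = 0"
      by (simp add: Phi_deriv_def col if_distrib[of "inner _"] cong: if_cong)
  next
    fix i assume i: "column i V \<noteq> 0"
    have "Phi_deriv q lam ?M (U, V) (0, K i (column_gradient q lam (transpose ?M) V U i)) = 0"
      by (intro deriv) (use i in \<open>auto simp: col\<close>)
    then show "column_gradient q lam (transpose ?M) V U i = 0"
      by (simp add: Phi_deriv_def col if_distrib[of "inner _"] cong: if_cong)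
  qed (use lam in simp)
next
  assume eqs: "critical_equations q lam (G (U ** transpose V)) U V"
  define S T where "S = {i. column i U \<noteq> 0}" and "T = {i. column i V \<noteq> 0}"
  show "critical_point (Phi q lam F) (U, V)"
  proof (rule critical_pointI_frechet, rule frechet_subdifferential_lower_bound)
    show "(partial_Phi q lam F S T has_derivative (\<lambda>h. 0 \<bullet> h)) (at (U, V))"
    proof -
      have "Phi_deriv q lam (G (U ** transpose V)) (U, V) h = 0 \<bullet> h" for h
        using eqs by (simp add: Phi_deriv_def critical_equations_def)
      \<comment> \<open>Outside \<open>S\<close> and \<open>T\<close> the columns of
        \<open>(U, V)\<close> vanish, so the orthogonality conditions hold for every
        \<open>h\<close>.\<close>
      note deriv = partial_Phi_deriv_eq_Phi_deriv[where x = "(U, V)" and S = S and T = T, THEN trans, OF _ _ _ this]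
      show ?thesis
        by (rule has_derivative_eq_rhs, rule has_derivative_partial_Phi[OF G(2)], use q in simp,
            simp_all add: S_def T_def)
          (intro ext deriv[unfolded S_def T_def, simplified], use q in auto)
    qed
    show "partial_Phi q lam F S T y \<le> Phi q lam F y" for y
      unfolding Phi_split[of _ _ _ _ S T] using q lam by (simp add: sum_nonneg)
    show "partial_Phi q lam F S T (U, V) = Phi q lam F (U, V)"
      unfolding Phi_split[of _ _ _ _ S T] by (simp add: S_def T_def)
  qed
qed

section \<open>Rotating the columns\<close>

text \<open>Tangent inequality for the concave map sending \<open>t\<close> to
  \<open>t powr (q / 2)\<close>, at \<open>t = r^2\<close> and evaluated at \<open>x^2\<close>. For
  \<open>x > 0\<close> it is weighted AM-GM with weights \<open>q / 2\<close> and
  \<open>1 - q / 2\<close>.\<close>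

lemma powr_le_tangent_in_square:
  fixes x r q :: real
  assumes "0 < q" "q < 2" "x \<ge> 0" "r > 0"
  shows "x powr q \<le> r powr q + q / 2 * (r powr (q - 2) * (x\<^sup>2 - r\<^sup>2))"
proof -
  have r2: "r powr (q - 2) * r\<^sup>2 = r powr q"
    using \<open>r > 0\<close> by (simp flip: powr_numeral powr_add)
  show ?thesis
  proof (cases "x = 0")
    case True
    have "0 \<le> (1 - q / 2) * r powr q"
      using assms by simp
    then show ?thesis
      by (simp add: True r2 left_diff_distrib)
  next
    case False
    then have "(x\<^sup>2) powr (q / 2) * (r\<^sup>2) powr (1 - q / 2) \<le> q / 2 * x\<^sup>2 + (1 - q / 2) * r\<^sup>2"
      using assms by (intro Youngs_inequality_0) auto
    moreover have "(x\<^sup>2) powr (q / 2) = x powr q" "(r\<^sup>2) powr (1 - q / 2) = r powr (2 - q)"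
      using assms False by (simp_all flip: powr_numeral add: powr_powr algebra_simps)
    ultimately have "r powr (q - 2) * (x powr q * r powr (2 - q)) \<le> r powr (q - 2) * (q / 2 * x\<^sup>2 + (1 - q / 2) * r\<^sup>2)"
      by (intro mult_left_mono) auto
    moreover have "r powr (q - 2) * (x powr q * r powr (2 - q)) = x powr q"
      using \<open>r > 0\<close> by (simp add: mult.left_commute flip: powr_add)
    moreover have "r powr (q - 2) * (q / 2 * x\<^sup>2 + (1 - q / 2) * r\<^sup>2) =
        r powr (q - 2) * r\<^sup>2 + q / 2 * (r powr (q - 2) * (x\<^sup>2 - r\<^sup>2))"
      by (simp add: algebra_simps)
    ultimately show ?thesis
      by (simp add: r2)
  qed
qed

lemma norm_powr_mult_inner_self: "norm u powr (q - 2) * (u \<bullet> u) = norm u powr q"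
proof (cases "u = 0")
  case False
  then show ?thesis
    by (simp add: dot_square_norm flip: powr_numeral powr_add)
qed simp

text \<open>Evaluating \<open>column i U \<bullet> (M *v column j V)\<close> through either equation
  relates the two Gram matrices entry by entry. The case \<open>i = j\<close> gives equal norms,
  hence equal weights for both factors.\<close>

lemma critical_equations_gram:
  assumes eqs: "critical_equations q lam M U V" and q: "q > 0" and lam: "lam > 0"
  shows "norm (column i U) = norm (column i V)"
    and "column i U \<bullet> column j U = column i V \<bullet> column j V"
    and "norm (column i U) powr (q - 2) \<noteq> norm (column j U) powr (q - 2) \<Longrightarrow> column i U \<bullet> column j U = 0"
proof -
  define w where "w i = norm (column i U) powr (q - 2)" for i
  have MV: "M *v column i V = - ((lam * w i) *\<^sub>R column i U)"
    and MU: "transpose M *v column i U = - ((lam * norm (column i V) powr (q - 2)) *\<^sub>R column i V)" for i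
    using eqs by (simp_all add: critical_equations_def column_gradient_def w_def eq_neg_iff_add_eq_0)
  have cross: "w j * (column i U \<bullet> column j U) = norm (column i V) powr (q - 2) * (column i V \<bullet> column j V)" for i j
    using inner_transpose_matrix_vector[of "column i U" M "column j V"] lam
    unfolding MU MV by (simp add: inner_commute)
  have norm_eq: "norm (column i U) = norm (column i V)" for i
  proof -
    have "norm (column i U) powr q = norm (column i V) powr q"
      using cross[of i i] by (simp add: w_def norm_powr_mult_inner_self)
    then have "(norm (column i U) powr q) powr (1 / q) = (norm (column i V) powr q) powr (1 / q)"
      by simp
    then show ?thesis
      using q by (simp add: powr_powr)
  qed
  then have c: "w j * (column i U \<bullet> column j U) = w i * (column i V \<bullet> column j V)" for i j
    using cross by (simp add: w_def)
  have orth: "column i U \<bullet> column j U = 0 \<and> column i V \<bullet> column j V = 0" if "w i \<noteq> w j" for i j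
  proof -
    \<comment> \<open>Exchanging \<open>i\<close> and \<open>j\<close> gives a second linear
      relation between the same two inner products; the determinant is, up to sign, the difference
      of the squared weights.\<close>
    have c': "w i * (column i U \<bullet> column j U) = w j * (column i V \<bullet> column j V)"
      using c[where i = j and j = i] by (simp add: inner_commute)
    have "((w j)\<^sup>2 - (w i)\<^sup>2) * (column i U \<bullet> column j U) = 0"
      "((w j)\<^sup>2 - (w i)\<^sup>2) * (column i V \<bullet> column j V) = 0"
      using c[where i = i and j = j] c' by algebra+
    \<comment> \<open>Weights are nonnegative, so distinct weights have distinct squares.\<close>
    moreover have "(w j)\<^sup>2 - (w i)\<^sup>2 \<noteq> 0"
      using that by (simp add: w_def power2_eq_iff_nonneg)
    ultimately show ?thesis
      by auto
  qed
  have gram: "column i U \<bullet> column j U = column i V \<bullet> column j V" for i j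
  \<comment> \<open>A common nonzero weight cancels in \<open>c\<close>. Distinct weights make both
    products \<open>0\<close>, and a common weight \<open>0\<close> means that the columns
    themselves vanish.\<close>
  proof (cases "w i = w j \<and> w i \<noteq> 0")
    case True
    then show ?thesis
      using c[where i = i and j = j] by auto
  next
    case False
    then show ?thesis
      using orth[of i j] norm_eq[of i] by (auto simp: w_def)
  qed
  show "norm (column i U) = norm (column i V)" "column i U \<bullet> column j U = column i V \<bullet> column j V"
    "norm (column i U) powr (q - 2) \<noteq> norm (column j U) powr (q - 2) \<Longrightarrow> column i U \<bullet> column j U = 0"
    using norm_eq gram orth by (auto simp: w_def)
qed

text \<open>The zero pattern says that \<open>E\<close> commutes with the diagonal matrix
  \<open>W\<close> of weights, so \<open>M B = c A W\<close> yields
  \<open>M B E = c A W E = c (A E) W\<close>.\<close>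

lemma column_mult_respecting_blocks:
  fixes A :: "real ^ 'd ^ 'm" and B :: "real ^ 'd ^ 'n" and E :: "real ^ 'd ^ 'd"
  assumes E: "\<And>i j. w i \<noteq> w j \<Longrightarrow> E $ i $ j = 0"
    and MB: "\<And>i. M *v column i B = (c * w i) *\<^sub>R column i A"
  shows "M *v column i (B ** E) = (c * w i) *\<^sub>R column i (A ** E)"
proof -
  have "M *v column i (B ** E) = (\<Sum>j\<in>UNIV. E $ j $ i *\<^sub>R (M *v column j B))"
    unfolding column_matrix_mult matrix_mult_sum[of B]
    by (simp add: column_def[of i E] scalar_mult_eq_scaleR linear_sum linear_scale)
  also have "\<dots> = (\<Sum>j\<in>UNIV. (c * w i) *\<^sub>R (E $ j $ i *\<^sub>R column j A))"
  proof (intro sum.cong refl)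
    fix j
    show "E $ j $ i *\<^sub>R (M *v column j B) = (c * w i) *\<^sub>R (E $ j $ i *\<^sub>R column j A)"
      using E[of j i] by (cases "w j = w i") (simp_all add: MB mult.commute)
  qed
  also have "\<dots> = (c * w i) *\<^sub>R column i (A ** E)"
    unfolding column_matrix_mult matrix_mult_sum[of A]
    by (simp add: column_def[of i E] scalar_mult_eq_scaleR scaleR_sum_right)
  finally show ?thesis .
qed

text \<open>The right-hand side depends on \<open>A\<close> only through its Gram matrix, so one
  \<open>E\<close> serves \<open>U\<close> and \<open>V\<close> alike.\<close>

lemma inner_columns_mult:
  fixes A :: "real ^ 'd ^ 'm" and E :: "real ^ 'd ^ 'd"
  shows "column i (A ** E) \<bullet> column j (A ** E) = column i E \<bullet> ((transpose A ** A) *v column j E)"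
  using inner_transpose_matrix_vector[of "A *v column j E" A "column i E"]
  by (simp only: column_matrix_mult matrix_vector_mul_assoc[symmetric] inner_commute)

text \<open>With \<open>W\<close> the diagonal matrix of weights, which commutes with \<^term>\<open>E\<close>, this is
  \<open>tr (W E\<^sup>T A\<^sup>T A E) = tr (W A\<^sup>T A)\<close>.\<close>

lemma weighted_sum_column_norms_invariant:
  fixes A :: "real ^ 'd ^ 'm" and E :: "real ^ 'd ^ 'd"
  assumes orth: "orthogonal_matrix E" and E: "\<And>i j. w i \<noteq> w j \<Longrightarrow> E $ i $ j = 0"
  shows "(\<Sum>i\<in>UNIV. w i * (norm (column i (A ** E)))\<^sup>2) = (\<Sum>i\<in>UNIV. w i * (norm (column i A))\<^sup>2)"
proof -
  have rows: "(\<Sum>i\<in>UNIV. E $ k $ i * E $ l $ i) = (if k = l then 1 else 0)" for k l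
  proof -
    have "(E ** transpose E) $ k $ l = (mat 1 :: real ^ 'd ^ 'd) $ k $ l"
      using orth by (simp add: orthogonal_matrix_def)
    then show ?thesis
      by (simp add: matrix_matrix_mult_def transpose_def mat_def)
  qed
  define S where "S k l = column k A \<bullet> column l A" for k l
  \<comment> \<open>Commutation moves the weight from the column index \<open>i\<close> to the row
    index \<open>k\<close>, which frees the sum over \<open>i\<close> for
    \<open>rows\<close>.\<close>
  have wE: "w i * E $ k $ i = w k * E $ k $ i" for i k
    using E[of k i] by (cases "w k = w i") auto
  have "w i * (norm (column i (A ** E)))\<^sup>2 = (\<Sum>k\<in>UNIV. \<Sum>l\<in>UNIV. (w k * S k l) * (E $ k $ i * E $ l $ i))" for i
  proof -
    have "(norm (column i (A ** E)))\<^sup>2 = (\<Sum>k\<in>UNIV. \<Sum>l\<in>UNIV. S k l * (E $ k $ i * E $ l $ i))"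
      unfolding power2_norm_eq_inner column_matrix_mult matrix_mult_sum[of A] inner_sum_left
      unfolding inner_sum_right
      by (simp add: S_def column_def[of i E] scalar_mult_eq_scaleR mult_ac)
    then have "w i * (norm (column i (A ** E)))\<^sup>2 = (\<Sum>k\<in>UNIV. \<Sum>l\<in>UNIV. S k l * ((w i * E $ k $ i) * E $ l $ i))"
      by (simp add: sum_distrib_left mult_ac)
    then show ?thesis
      unfolding wE by (simp add: mult_ac)
  qed
  then have "(\<Sum>i\<in>UNIV. w i * (norm (column i (A ** E)))\<^sup>2) =
      (\<Sum>i\<in>UNIV. \<Sum>k\<in>UNIV. \<Sum>l\<in>UNIV. (w k * S k l) * (E $ k $ i * E $ l $ i))"
    by simp
  also have "\<dots> = (\<Sum>k\<in>UNIV. \<Sum>i\<in>UNIV. \<Sum>l\<in>UNIV. (w k * S k l) * (E $ k $ i * E $ l $ i))"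
    by (rule sum.swap)
  also have "\<dots> = (\<Sum>k\<in>UNIV. \<Sum>l\<in>UNIV. \<Sum>i\<in>UNIV. (w k * S k l) * (E $ k $ i * E $ l $ i))"
    by (intro sum.cong refl sum.swap)
  also have "\<dots> = (\<Sum>k\<in>UNIV. w k * S k k)"
    by (simp add: rows flip: sum_distrib_left) (simp add: if_distrib cong: if_cong)
  finally show ?thesis
    by (simp add: S_def power2_norm_eq_inner)
qed

lemma D_mat_eq_iff:
  fixes A B :: "real ^ 'd ^ 'k"
  shows "D_mat q A = D_mat q B \<longleftrightarrow> (\<forall>i. norm (column i A) powr (q - 2) = norm (column i B) powr (q - 2))"
proof -
  have entry: "D_mat q C $ i $ j = (if i = j then norm (column i C) powr (q - 2) else 0)" for C i j
    by (simp add: D_mat_def)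
  have "D_mat q A = D_mat q B \<longleftrightarrow> (\<forall>i j. D_mat q A $ i $ j = D_mat q B $ i $ j)"
    by (simp add: vec_eq_iff)
  then show ?thesis
    by (auto simp: entry)
qed

text \<open>The weight \<open>0\<close> occurs exactly at zero columns, so \<open>E\<close> combines
  zero columns only with one another.\<close>

lemma column_mult_eq_0:
  fixes A :: "real ^ 'd ^ 'm" and E :: "real ^ 'd ^ 'd"
  assumes E: "\<And>i j. norm (column i A) powr p \<noteq> norm (column j A) powr p \<Longrightarrow> E $ i $ j = 0"
    and i: "column i A = 0"
  shows "column i (A ** E) = 0"
proof -
  have "E $ j $ i *\<^sub>R column j A = 0" for j
    using E[of j i] i by (cases "column j A = 0") auto
  then show ?thesis
    unfolding column_matrix_mult matrix_mult_sum[of A]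
    by (simp add: column_def[of i E] scalar_mult_eq_scaleR sum.neutral del: scaleR_eq_0_iff)
qed

text \<open>The tangent inequality is summed with \<open>r\<close> the old column norm; the
  first-order terms cancel by invariance of the weighted trace. Zero columns, where no tangent is
  available, stay zero.\<close>

lemma norm2q_pow_mult_le:
  fixes A :: "real ^ 'd ^ 'm" and E :: "real ^ 'd ^ 'd"
  assumes q: "0 < q" "q < 2" and orth: "orthogonal_matrix E"
    and E: "\<And>i j. norm (column i A) powr (q - 2) \<noteq> norm (column j A) powr (q - 2) \<Longrightarrow> E $ i $ j = 0"
  shows "norm2q_pow q (A ** E) \<le> norm2q_pow q A"
proof -
  define w where "w i = norm (column i A) powr (q - 2)" for i
  have "norm (column i (A ** E)) powr q \<le> norm (column i A) powr q +
      q / 2 * (w i * ((norm (column i (A ** E)))\<^sup>2 - (norm (column i A))\<^sup>2))" for i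
  proof (cases "column i A = 0")
    case True
    with column_mult_eq_0[OF E this] show ?thesis
      by simp
  next
    case False
    then show ?thesis
      unfolding w_def using q by (intro powr_le_tangent_in_square) auto
  qed
  then have "norm2q_pow q (A ** E) \<le> (\<Sum>i\<in>UNIV. norm (column i A) powr q +
      q / 2 * (w i * ((norm (column i (A ** E)))\<^sup>2 - (norm (column i A))\<^sup>2)))"
    unfolding norm2q_pow_def by (intro sum_mono)
  also have "\<dots> = norm2q_pow q A + q / 2 *
      ((\<Sum>i\<in>UNIV. w i * (norm (column i (A ** E)))\<^sup>2) - (\<Sum>i\<in>UNIV. w i * (norm (column i A))\<^sup>2))"
    by (simp add: norm2q_pow_def sum.distrib sum_subtractf sum_distrib_left right_diff_distrib)
  also have "\<dots> = norm2q_pow q A"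
    using weighted_sum_column_norms_invariant[OF orth, of w A] E by (simp add: w_def)
  finally show ?thesis .
qed

text \<open>A column of \<^term>\<open>A ** E\<close> with a different weight would have to vanish while the corresponding
  column of \<^term>\<open>A\<close> does not, which strictly decreases the weighted trace.\<close>

lemma norm_columns_mult_eq:
  fixes A :: "real ^ 'd ^ 'm" and E :: "real ^ 'd ^ 'd"
  assumes q: "q < 2" and orth: "orthogonal_matrix E"
    and E: "\<And>i j. norm (column i A) powr (q - 2) \<noteq> norm (column j A) powr (q - 2) \<Longrightarrow> E $ i $ j = 0"
    and cols: "\<And>i. column i (A ** E) = 0 \<or> norm (column i (A ** E)) powr (q - 2) = norm (column i A) powr (q - 2)"
  shows "norm (column i (A ** E)) = norm (column i A)"
proof -
  define w where "w i = norm (column i A) powr (q - 2)" for i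
  have le: "norm (column i (A ** E)) \<le> norm (column i A)" for i
  proof (cases "column i (A ** E) = 0")
    case False
    \<comment> \<open>As \<open>q - 2\<close> is nonzero, the weight of a nonzero column determines
      its norm.\<close>
    then have "(norm (column i (A ** E)) powr (q - 2)) powr (1 / (q - 2)) = (norm (column i A) powr (q - 2)) powr (1 / (q - 2))"
      using cols[of i] by auto
    then show ?thesis
      using q by (simp add: powr_powr)
  qed simp
  have term_le: "w i * (norm (column i (A ** E)))\<^sup>2 \<le> w i * (norm (column i A))\<^sup>2" for i
    using le by (intro mult_left_mono power_mono) (simp_all add: w_def)
  have "w i * (norm (column i (A ** E)))\<^sup>2 = w i * (norm (column i A))\<^sup>2"
  proof (rule ccontr)
    assume "w i * (norm (column i (A ** E)))\<^sup>2 \<noteq> w i * (norm (column i A))\<^sup>2"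
    then have "w i * (norm (column i (A ** E)))\<^sup>2 < w i * (norm (column i A))\<^sup>2"
      using term_le[of i] by linarith
    then have "(\<Sum>i\<in>UNIV. w i * (norm (column i (A ** E)))\<^sup>2) < (\<Sum>i\<in>UNIV. w i * (norm (column i A))\<^sup>2)"
      using term_le by (intro sum_strict_mono_ex1) auto
    then show False
      using weighted_sum_column_norms_invariant[OF orth, of w A] E by (simp add: w_def)
  qed
  \<comment> \<open>A nonzero column of \<open>A\<close> has positive weight, which cancels; a zero
    column stays zero.\<close>
  then show ?thesis
    using column_mult_eq_0[of A "q - 2" E i, OF E] by (cases "column i A = 0") (auto simp: w_def)
qed

theorem theorem3p3:
  fixes F :: "real ^ 'n ^ 'm \<Rightarrow> real"
    and U :: "real ^ 'd ^ 'm" and V :: "real ^ 'd ^ 'n"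
    and q lam :: real
  assumes "0 < q" and "q < 2" and "lam > 0"
    and "continuously_differentiable F"
    and "critical_point (Phi q lam F) (U, V)"
  shows "\<exists>E :: real ^ 'd ^ 'd.
      U ** transpose V = (U ** E) ** transpose (V ** E) \<and>
      columnwise_orthogonal (U ** E) \<and> columnwise_orthogonal (V ** E) \<and>
      (critical_point (Phi q lam F) (U ** E, V ** E) \<or> \<not> global_minimizer (Phi q lam F) (U, V)) \<and>
      (critical_point (Phi q lam F) (U ** E, V ** E) \<longleftrightarrow> D_mat q U = D_mat q (U ** E))"
proof -
  obtain G where G: "continuous_on UNIV G" "\<And>X. (F has_derivative (\<lambda>h. G X \<bullet> h)) (at X)"
    using continuously_differentiable_gradient[OF assms(4)] by blast
  note crit_iff = critical_point_Phi_iff[OF G assms(1,3)]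
  define M where "M = G (U ** transpose V)"
  have eqs: "critical_equations q lam M U V"
    using assms(5) by (simp add: crit_iff M_def)
  note gram = critical_equations_gram[OF eqs assms(1,3)]
  define w where "w i = norm (column i U) powr (q - 2)" for i
  have wV: "norm (column i V) powr (q - 2) = w i" for i
    by (simp add: w_def gram(1))
  have gram_eq: "transpose U ** U = transpose V ** V"
    unfolding matrix_mult_transpose_dot_column using gram(2) by (simp add: vec_eq_iff)
  obtain E :: "real ^ 'd ^ 'd" where orth: "orthogonal_matrix E"
    and E: "\<And>i j. w i \<noteq> w j \<Longrightarrow> E $ i $ j = 0"
    and diag: "\<And>i j. i \<noteq> j \<Longrightarrow> column i E \<bullet> ((transpose U ** U) *v column j E) = 0"
  proof (rule symmetric_diagonalization_respecting_blocks[of "transpose U ** U" w])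
    show "transpose (transpose U ** U) = transpose U ** U"
      by (simp add: matrix_transpose_mul)
    show "w i \<noteq> w j \<Longrightarrow> (transpose U ** U) $ i $ j = 0" for i j
      using gram(3)[of i j] by (simp add: matrix_mult_transpose_dot_column w_def)
  qed blast
  have EU: "\<And>i j. norm (column i U) powr (q - 2) \<noteq> norm (column j U) powr (q - 2) \<Longrightarrow> E $ i $ j = 0"
    and EV: "\<And>i j. norm (column i V) powr (q - 2) \<noteq> norm (column j V) powr (q - 2) \<Longrightarrow> E $ i $ j = 0"
    using E by (simp_all add: w_def gram(1))
  have prod: "(U ** E) ** transpose (V ** E) = U ** transpose V"
  proof -
    have "(U ** E) ** transpose (V ** E) = U ** (E ** transpose E) ** transpose V"
      by (simp add: matrix_transpose_mul matrix_mul_assoc)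
    then show ?thesis
      using orth by (simp add: orthogonal_matrix_def)
  qed
  have orthU: "columnwise_orthogonal (U ** E)" and orthV: "columnwise_orthogonal (V ** E)"
    using diag by (simp_all add: columnwise_orthogonal_def orthogonal_def inner_columns_mult gram_eq)
  have norm_eq: "norm (column i (U ** E)) = norm (column i (V ** E))" for i
    by (simp add: norm_eq_sqrt_inner inner_columns_mult gram_eq)
  have MV: "M *v column i V = ((- lam) * w i) *\<^sub>R column i U"
    and MU: "transpose M *v column i U = ((- lam) * w i) *\<^sub>R column i V" for i
    using eqs by (simp_all add: critical_equations_def column_gradient_def wV w_def[symmetric] eq_neg_iff_add_eq_0)
  have MVE: "M *v column i (V ** E) = ((- lam) * w i) *\<^sub>R column i (U ** E)"
    and MUE: "transpose M *v column i (U ** E) = ((- lam) * w i) *\<^sub>R column i (V ** E)" for i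
    by (rule column_mult_respecting_blocks; fact E MV MU)+
  \<comment> \<open>The transported equations carry the old weights \<open>w i\<close>, so what
    remains of the gradient is the change of weight.\<close>
  have grad_U: "column_gradient q lam M (U ** E) (V ** E) i =
      (lam * (norm (column i (U ** E)) powr (q - 2) - w i)) *\<^sub>R column i (U ** E)" for i
    unfolding column_gradient_def MVE by (simp add: algebra_simps)
  have grad_V: "column_gradient q lam (transpose M) (V ** E) (U ** E) i =
      (lam * (norm (column i (U ** E)) powr (q - 2) - w i)) *\<^sub>R column i (V ** E)" for i
    unfolding column_gradient_def MUE norm_eq by (simp add: algebra_simps)
  have "column i (V ** E) = 0 \<longleftrightarrow> column i (U ** E) = 0" for i
    using norm_eq[of i] by (metis norm_eq_zero)
  then have crit: "critical_point (Phi q lam F) (U ** E, V ** E) \<longleftrightarrow>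
      (\<forall>i. column i (U ** E) = 0 \<or> norm (column i (U ** E)) powr (q - 2) = w i)"
    unfolding crit_iff prod M_def[symmetric] critical_equations_def grad_U grad_V
    using assms(3) by auto
  \<comment> \<open>By itself \<open>crit\<close> allows columns of \<open>U ** E\<close> to vanish
    where those of \<open>U\<close> do not; the trace argument excludes this.\<close>
  have "norm (column i (U ** E)) = norm (column i U)"
    if "critical_point (Phi q lam F) (U ** E, V ** E)" for i
    by (rule norm_columns_mult_eq[OF assms(2) orth]) (use EU that in \<open>auto simp: crit w_def\<close>)
  then have "critical_point (Phi q lam F) (U ** E, V ** E) \<longleftrightarrow> D_mat q U = D_mat q (U ** E)"
    unfolding D_mat_eq_iff by (auto simp: crit w_def)
  \<comment> \<open>The product, and with it the \<open>F\<close> term, is unchanged while neither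
    penalty increases, so a global minimizer is sent to a global minimizer.\<close>
  moreover have "critical_point (Phi q lam F) (U ** E, V ** E)" if min: "global_minimizer (Phi q lam F) (U, V)"
  proof (rule global_minimizer_critical_point)
    have "Phi q lam F (U ** E, V ** E) \<le> Phi q lam F (U, V)"
      using norm2q_pow_mult_le[OF assms(1,2) orth, of U, OF EU] norm2q_pow_mult_le[OF assms(1,2) orth, of V, OF EV] assms(1,3)
      by (auto simp: Phi_def prod intro!: divide_right_mono mult_left_mono)
    with min show "global_minimizer (Phi q lam F) (U ** E, V ** E)"
      unfolding global_minimizer_def by (meson order_trans)
  qed
  ultimately show ?thesis
    using prod orthU orthV by (intro exI[of _ E]) auto
qed

end
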